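(* Let $(Z,\preceq)$ be a preordered set and let $\Psi$ be a family of functions $\psi\colon Z\to\mathbb{R}\cup\{\pm\infty\}$ which are monotone with respect to $\preceq$. For $D,E\in\mathcal{P}(Z,\Psi)$, \[ D\preceq_\Psi E\quad\Leftrightarrow\quad D\supseteq E . \] Moreover, the pair $(\mathcal{P}(Z,\Psi),\supseteq)$ is a complete lattice, and for each $\mathcal{A}\subseteq\mathcal{P}(Z,\Psi)$, \[ \inf\mathcal{A}=\operatorname{cl}_\Psi\bigcup_{A\in\mathcal{A}}A\quad\text{and}\quad \sup\mathcal{A}=\bigcap_{A\in\mathcal{A}}A, \] where the infimum and the supremum are taken with respect to $\supseteq$.
   Context: A preorder is a reflexive and transitive relation. A function $\psi\colon Z\to\mathbb{R}\cup\{\pm\infty\}$ is monotone if $z_1\preceq z_2$ implies $\psi(z_1)\le\psi(z_2)$. $\mathcal{P}(Z)$ is the set of all subsets of $Z$, including $\emptyset$. For $D\in\mathcal{P}(Z)$, $\psi^\triangle(D)=\inf_{z\in D}\psi(z)$ (with $\inf_{z\in\emptyset}\psi(z)=+\infty$) and $\operatorname{cl}_\Psi D=\bigcap_{\psi\in\Psi}\{z\in Z\mid \psi^\triangle(D)\le\psi(z)\}$. The relation $\preceq_\Psi$ on $\mathcal{P}(Z)$ is defined by $D_1\preceq_\Psi D_2$ iff $\psi^\triangle(D_1)\le\psi^\triangle(D_2)$ for all $\psi\in\Psi$. $\mathcal{P}(Z,\Psi)=\{D\in\mathcal{P}(Z)\mid D=\operatorname{cl}_\Psi D\}$. Taken with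 respect to $\supseteq$ means that $D$ is regarded as less than or equal to $E$ when $D\supseteq E$. The intersection over an empty family of subsets of $Z$ is $Z$. *)

theory Defs
  imports "HOL-Algebra.Complete_Lattice" "HOL-Library.Extended_Real"
begin

definition inf_ext :: "('z \<Rightarrow> ereal) \<Rightarrow> 'z set \<Rightarrow> ereal" where
  "inf_ext \<psi> D = (INF z\<in>D. \<psi> z)"

text \<open>
  The outer intersection with the ground set \<open>Z\<close> only matters for \<open>\<Psi> = {}\<close>: the empty
  intersection of subsets of \<open>Z\<close> is \<open>Z\<close>, not the universe of the type.
\<close>

definition cl_fam :: "'z set \<Rightarrow> ('z \<Rightarrow> ereal) set \<Rightarrow> 'z set \<Rightarrow> 'z set" where
  "cl_fam Z \<Psi> D = Z \<inter> (\<Inter>\<psi>\<in>\<Psi>. {z \<in> Z. inf_ext \<psi> D \<le> \<psi> z})"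

definition le_fam :: "('z \<Rightarrow> ereal) set \<Rightarrow> 'z set \<Rightarrow> 'z set \<Rightarrow> bool" where
  "le_fam \<Psi> D\<^sub>1 D\<^sub>2 \<longleftrightarrow> (\<forall>\<psi>\<in>\<Psi>. inf_ext \<psi> D\<^sub>1 \<le> inf_ext \<psi> D\<^sub>2)"

definition closed_sets :: "'z set \<Rightarrow> ('z \<Rightarrow> ereal) set \<Rightarrow> 'z set set" where
  "closed_sets Z \<Psi> = {D \<in> Pow Z. D = cl_fam Z \<Psi> D}"

definition closed_sets_order :: "'z set \<Rightarrow> ('z \<Rightarrow> ereal) set \<Rightarrow> 'z set gorder" where
  "closed_sets_order Z \<Psi> = \<lparr>carrier = closed_sets Z \<Psi>, eq = (=), le = (\<lambda>D E. D \<supseteq> E)\<rparr>"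

end

theory Submission
  imports Defs
begin

text \<open>
  A number is at most an infimum over \<open>E\<close> exactly when it is at most every value on \<open>E\<close>. Hence, for
  \<open>E \<subseteq> Z\<close>, the relation \<open>le_fam \<Psi> D E\<close> says that each \<open>z \<in> E\<close> satisfies all the inequalities that
  define \<open>cl_fam Z \<Psi> D\<close>, that is, \<open>E \<subseteq> cl_fam Z \<Psi> D\<close> (\<open>le_fam_iff_subset_cl_fam\<close>). If \<open>D\<close> is
  closed, the right-hand side is \<open>E \<subseteq> D\<close>, which is the first claim.

  Since \<open>le_fam \<Psi>\<close> is reflexive and transitive, the same equivalence makes \<open>cl_fam Z \<Psi>\<close> extensive
  and idempotent on the subsets of \<open>Z\<close>; it is also monotone, so it is a closure operator. The rest
  is the standard fact that the closed sets of a closure operator form a complete lattice: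
  intersections of closed sets are closed (\<open>Inter_closed\<close>), and the closure of a union is the
  smallest closed set that contains it (\<open>cl_fam_least\<close>). Under reverse inclusion these are the
  suprema and infima. The empty family is covered as well: its supremum is \<open>Z\<close>, and its infimum
  is the closure of the empty set, the smallest closed set.
\<close>

lemma le_fam_iff_subset_cl_fam:
  assumes "E \<subseteq> Z"
  shows "le_fam \<Psi> D E \<longleftrightarrow> E \<subseteq> cl_fam Z \<Psi> D"
  using assms unfolding le_fam_def cl_fam_def inf_ext_def
  by (auto simp: le_INF_iff)

lemma cl_fam_subset: "cl_fam Z \<Psi> D \<subseteq> Z"
  by (auto simp: cl_fam_def)

lemma subset_cl_fam:
  assumes "D \<subseteq> Z"
  shows "D \<subseteq> cl_fam Z \<Psi> D"
  using le_fam_iff_subset_cl_fam[OF assms, of \<Psi> D] by (simp add: le_fam_def)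

text \<open>
  Enlarging \<open>D\<close> lowers every infimum \<open>inf_ext \<psi> D\<close> and so weakens the inequalities that cut out the
  closure.
\<close>

lemma cl_fam_mono:
  assumes "D \<subseteq> E"
  shows "cl_fam Z \<Psi> D \<subseteq> cl_fam Z \<Psi> E"
proof -
  have "inf_ext \<psi> E \<le> inf_ext \<psi> D" for \<psi>
    unfolding inf_ext_def using assms by (rule INF_superset_mono) simp
  then have "inf_ext \<psi> E \<le> \<psi> z" if "inf_ext \<psi> D \<le> \<psi> z" for \<psi> z
    using that by (rule order_trans)
  then show ?thesis
    unfolding cl_fam_def by blast
qed

text \<open>
  Each closure step can only go up in \<open>le_fam \<Psi>\<close>; by transitivity two steps reach nothing that one
  step does not.
\<close>

lemma cl_fam_idem: "cl_fam Z \<Psi> (cl_fam Z \<Psi> D) \<subseteq> cl_fam Z \<Psi> D"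
proof -
  let ?C = "cl_fam Z \<Psi> D"
  have "le_fam \<Psi> D ?C" "le_fam \<Psi> ?C (cl_fam Z \<Psi> ?C)"
    by (simp_all add: le_fam_iff_subset_cl_fam[OF cl_fam_subset])
  then have "le_fam \<Psi> D (cl_fam Z \<Psi> ?C)"
    unfolding le_fam_def by (meson order_trans)
  then show ?thesis
    by (simp add: le_fam_iff_subset_cl_fam[OF cl_fam_subset])
qed

lemma closed_setsI:
  assumes "D \<subseteq> Z" and "cl_fam Z \<Psi> D \<subseteq> D"
  shows "D \<in> closed_sets Z \<Psi>"
  using assms subset_cl_fam[OF assms(1), of \<Psi>] by (auto simp: closed_sets_def)

lemma closed_setsD:
  assumes "D \<in> closed_sets Z \<Psi>"
  shows "D \<subseteq> Z" and "cl_fam Z \<Psi> D = D"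
  using assms by (auto simp: closed_sets_def)

lemma cl_fam_closed: "cl_fam Z \<Psi> D \<in> closed_sets Z \<Psi>"
  by (intro closed_setsI cl_fam_subset cl_fam_idem)

lemma cl_fam_least:
  assumes "D \<subseteq> E" and "E \<in> closed_sets Z \<Psi>"
  shows "cl_fam Z \<Psi> D \<subseteq> E"
  using cl_fam_mono[OF assms(1), of Z \<Psi>] closed_setsD(2)[OF assms(2)] by simp

text \<open>
  The factor \<open>Z\<close> is needed for \<open>\<A> = {}\<close>, where \<open>\<Inter>\<A>\<close> is the whole type.
\<close>

lemma Inter_closed:
  assumes "\<A> \<subseteq> closed_sets Z \<Psi>"
  shows "Z \<inter> \<Inter>\<A> \<in> closed_sets Z \<Psi>"
proof (rule closed_setsI)
  have "cl_fam Z \<Psi> (Z \<inter> \<Inter>\<A>) \<subseteq> A" if "A \<in> \<A>" for A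
    using that assms by (intro cl_fam_least) auto
  then have "cl_fam Z \<Psi> (Z \<inter> \<Inter>\<A>) \<subseteq> \<Inter>\<A>"
    by (rule Inter_greatest)
  then show "cl_fam Z \<Psi> (Z \<inter> \<Inter>\<A>) \<subseteq> Z \<inter> \<Inter>\<A>"
    using cl_fam_subset[of Z \<Psi> "Z \<inter> \<Inter>\<A>"] by simp
qed simp

lemma partial_order_closed_sets_order: "partial_order (closed_sets_order Z \<Psi>)"
  by unfold_locales (auto simp: closed_sets_order_def)

lemma greatest_closed_sets_order:
  assumes "\<A> \<subseteq> closed_sets Z \<Psi>"
  shows "greatest (closed_sets_order Z \<Psi>) (cl_fam Z \<Psi> (\<Union>\<A>)) (Lower (closed_sets_order Z \<Psi>) \<A>)"
proof (rule greatest_LowerI)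
  let ?L = "closed_sets_order Z \<Psi>"
  have "\<Union>\<A> \<subseteq> Z"
    using assms closed_setsD(1) by blast
  then have "\<Union>\<A> \<subseteq> cl_fam Z \<Psi> (\<Union>\<A>)"
    by (rule subset_cl_fam)
  then show "le ?L (cl_fam Z \<Psi> (\<Union>\<A>)) A" if "A \<in> \<A>" for A
    using that by (auto simp: closed_sets_order_def)
  show "le ?L E (cl_fam Z \<Psi> (\<Union>\<A>))" if "E \<in> Lower ?L \<A>" for E
  proof -
    have "E \<in> closed_sets Z \<Psi>" and "\<Union>\<A> \<subseteq> E"
      using that assms by (auto simp: Lower_def closed_sets_order_def)
    then show ?thesis
      by (simp add: closed_sets_order_def cl_fam_least)
  qed
qed (use assms in \<open>simp_all add: closed_sets_order_def cl_fam_closed\<close>)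

lemma least_closed_sets_order:
  assumes "\<A> \<subseteq> closed_sets Z \<Psi>"
  shows "least (closed_sets_order Z \<Psi>) (Z \<inter> \<Inter>\<A>) (Upper (closed_sets_order Z \<Psi>) \<A>)"
proof (rule least_UpperI)
  let ?L = "closed_sets_order Z \<Psi>"
  show "le ?L A (Z \<inter> \<Inter>\<A>)" if "A \<in> \<A>" for A
    using that by (auto simp: closed_sets_order_def)
  show "le ?L (Z \<inter> \<Inter>\<A>) E" if "E \<in> Upper ?L \<A>" for E
  proof -
    have "E \<in> closed_sets Z \<Psi>" and "E \<subseteq> \<Inter>\<A>"
      using that assms by (auto simp: Upper_def closed_sets_order_def)
    then show ?thesis
      using closed_setsD(1)[of E Z \<Psi>] by (simp add: closed_sets_order_def)
  qed
qed (use assms Inter_closed[OF assms] in \<open>simp_all add: closed_sets_order_def\<close>)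

theorem proposition2p3:
  fixes Z :: "'z set" and r :: "('z \<times> 'z) set" and \<Psi> :: "('z \<Rightarrow> ereal) set"
  assumes "preorder_on Z r"
    and "\<And>\<psi>. \<psi> \<in> \<Psi> \<Longrightarrow> monotone_on Z (\<lambda>z\<^sub>1 z\<^sub>2. (z\<^sub>1, z\<^sub>2) \<in> r) (\<le>) \<psi>"
  shows "(\<forall>D \<in> closed_sets Z \<Psi>. \<forall>E \<in> closed_sets Z \<Psi>. le_fam \<Psi> D E \<longleftrightarrow> D \<supseteq> E) \<and>
    complete_lattice (closed_sets_order Z \<Psi>) \<and>
    (\<forall>\<A> \<subseteq> closed_sets Z \<Psi>.
      \<Sqinter>\<^bsub>closed_sets_order Z \<Psi>\<^esub> \<A> = cl_fam Z \<Psi> (\<Union>A\<in>\<A>. A) \<and>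
      \<Squnion>\<^bsub>closed_sets_order Z \<Psi>\<^esub> \<A> = Z \<inter> (\<Inter>A\<in>\<A>. A))"
proof (intro conjI ballI allI impI)
  let ?L = "closed_sets_order Z \<Psi>"
  interpret partial_order ?L
    by (rule partial_order_closed_sets_order)
  have carrier: "carrier ?L = closed_sets Z \<Psi>"
    by (simp add: closed_sets_order_def)
  show "le_fam \<Psi> D E \<longleftrightarrow> D \<supseteq> E" if "D \<in> closed_sets Z \<Psi>" "E \<in> closed_sets Z \<Psi>" for D E
    using le_fam_iff_subset_cl_fam[OF closed_setsD(1)[OF that(2)], of \<Psi> D]
      closed_setsD(2)[OF that(1)] by simp
  show "complete_lattice ?L"
  proof (rule complete_latticeI)
    fix \<A> assume "\<A> \<subseteq> carrier ?L"
    then have "\<A> \<subseteq> closed_sets Z \<Psi>"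
      by (simp only: carrier)
    then show "\<exists>s. least ?L s (Upper ?L \<A>)" "\<exists>i. greatest ?L i (Lower ?L \<A>)"
      by (blast intro: least_closed_sets_order greatest_closed_sets_order)+
  qed
  fix \<A> assume \<A>: "\<A> \<subseteq> closed_sets Z \<Psi>"
  have "\<Sqinter>\<^bsub>?L\<^esub> \<A> = cl_fam Z \<Psi> (\<Union>\<A>)"
    unfolding inf_def
    using greatest_closed_sets_order[OF \<A>] greatest_unique[OF _ greatest_closed_sets_order[OF \<A>]]
    by (rule some_equality)
  then show "\<Sqinter>\<^bsub>?L\<^esub> \<A> = cl_fam Z \<Psi> (\<Union>A\<in>\<A>. A)"
    by simp
  have "\<Squnion>\<^bsub>?L\<^esub> \<A> = Z \<inter> \<Inter>\<A>"
    unfolding sup_def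
    using least_closed_sets_order[OF \<A>] least_unique[OF _ least_closed_sets_order[OF \<A>]]
    by (rule some_equality)
  then show "\<Squnion>\<^bsub>?L\<^esub> \<A> = Z \<inter> (\<Inter>A\<in>\<A>. A)"
    by simp
qed

end
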